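(* Let $a,b,c,d$ be positive real numbers with $\min\{c,d\}>\max\{a,b\}$, and let $\{P_n(x)\}_{n\in\mathbb{N}}$, $P_n(x):=P_n(x;a,b;c,d)$, be the monic $2$-orthogonal polynomial sequence with respect to the weight vector $\overline{\mathcal{W}}(x;a,b;c,d)$. Then, with $P_{-2}=P_{-1}=0$ and $P_0=1$, for all $n\in\mathbb{N}$, $$P_{n+1}(x)=(x-\beta_n)P_n(x)-\alpha_nP_{n-1}(x)-\gamma_{n-1}P_{n-2}(x),$$ where, for each $n\in\mathbb{N}$, $$\beta_n=\frac{(n+1)(a+n)(b+n)}{(c'_{n-1}+n)(c'_n+n)}-\frac{n(a+n-1)(b+n-1)}{(c'_{n-1}+n-1)(c'_n+n-2)},$$ $$\alpha_{n+1}=\frac{(n+1)(a+n)(b+n)}{(c'_{n-1}+n)(c'_n+n)}\Bigg(\frac{n(a+n-1)(b+n-1)}{2(c'_{n-1}+n-1)(c'_n+n-1)}-\frac{(n+1)(a+n)(b+n)}{(c'_{n-1}+n)(c'_n+n)}+\frac{(n+2)(a+n+1)(b+n+1)}{2(c'_{n-1}+n+1)(c'_n+n+1)}\Bigg)$$ and $$\gamma_{n+1}=\frac{(n+1)_2\,(a+n)_2\,(b+n)_2\,(c'_n-1)(c'_n-a)(c'_n-b)}{(c'_{n-1}+n)_3\,(c'_n+n)_3\,(c'_n+n-1)_3},$$ with $c'_n=c+k$ if $n=2k-1$ and $c'_n=d+k$ if $n=2k$ ($k\in\mathbb{N}$). Here, for $n=0$, the terms with numerator factor $n$ are read as $0$,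 and the factor $c'_0-1=d-1$ in the numerator of $\gamma_1$ is cancelled against the first factor of $(c'_0-1)_3=(d-1)d(d+1)$.
   Context: $\mathbb{N}=\{0,1,2,\dots\}$; $(z)_0=1$ and $(z)_n=z(z+1)\cdots(z+n-1)$. For positive reals $a,b,c,d$ with $\delta:=c+d-a-b>0$, the function $\mathcal{W}(\cdot\,;a,b;c,d)$ on $(0,1)$ is $$\mathcal{W}(x;a,b;c,d)=\frac{\Gamma(c)\Gamma(d)}{\Gamma(a)\Gamma(b)\Gamma(\delta)}\,x^{a-1}(1-x)^{\delta-1}\,{}_2F_1(c-b,d-b;\delta;1-x),$$ where ${}_2F_1(\alpha,\beta;\gamma;z)=\sum_{n\ge0}\frac{(\alpha)_n(\beta)_n}{(\gamma)_n}\frac{z^n}{n!}$ for $|z|<1$. (The condition $\min\{c,d\}>\max\{a,b\}$ implies $\delta>0$.) The weight vector $\overline{\mathcal{W}}(x;a,b;c,d)$ has components $w_0(x)=\mathcal{W}(x;a,b;c,d)$ and $w_1(x)=\mathcal{W}(x;a,b+1;c+1,d)$. A sequence of monic polynomials $\{P_n\}_{n\in\mathbb{N}}$ with $\deg P_n=n$ is the monic $2$-orthogonal polynomial sequence with respect to $\overline{\mathcal{W}}(x;a,b;c,d)$ if, for each $j\in\{0,1\}$ and $k,n\in\mathbb{N}$, $\int_0^1x^kP_n(x)w_j(x)\,\mathrm{d}x$ equals $0$ if $n\ge 2k+j+1$ and is nonzero if $n=2k+j$. For these weights it exists and is unique. The values of $\alpha_0,\gamma_{-1},\gamma_0$ are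 irrelevant since they multiply zero polynomials. *)

theory Defs
  imports "HOL-Analysis.Analysis" "HOL-Computational_Algebra.Polynomial"
begin

definition hyp2F1 :: "real \<Rightarrow> real \<Rightarrow> real \<Rightarrow> real \<Rightarrow> real" where
  "hyp2F1 \<alpha> \<beta> \<gamma> z =
     (\<Sum>n. pochhammer \<alpha> n * pochhammer \<beta> n / pochhammer \<gamma> n * (z ^ n / fact n))"

definition weight :: "real \<Rightarrow> real \<Rightarrow> real \<Rightarrow> real \<Rightarrow> real \<Rightarrow> real" where
  "weight a b c d x =
     (let \<delta> = c + d - a - b in
        Gamma c * Gamma d / (Gamma a * Gamma b * Gamma \<delta>)
        * x powr (a - 1) * (1 - x) powr (\<delta> - 1)
        * hyp2F1 (c - b) (d - b) \<delta> (1 - x))"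

text \<open>Only the components \<open>j = 0\<close> and \<open>j = 1\<close> of the weight vector are used.\<close>

definition weight_vec :: "real \<Rightarrow> real \<Rightarrow> real \<Rightarrow> real \<Rightarrow> nat \<Rightarrow> real \<Rightarrow> real" where
  "weight_vec a b c d j = (if j = 0 then weight a b c d else weight a (b + 1) (c + 1) d)"

definition monic_2_orthogonal :: "(nat \<Rightarrow> real \<Rightarrow> real) \<Rightarrow> (nat \<Rightarrow> real poly) \<Rightarrow> bool" where
  "monic_2_orthogonal w P \<longleftrightarrow>
     (\<forall>n. degree (P n) = n \<and> lead_coeff (P n) = 1) \<and>
     (\<forall>j\<in>{0, 1}. \<forall>k n.
        (n \<ge> 2 * k + j + 1 \<longrightarrow>
           (LBINT x:{0<..<1}. x ^ k * poly (P n) x * w j x) = 0) \<and>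
        (n = 2 * k + j \<longrightarrow>
           (LBINT x:{0<..<1}. x ^ k * poly (P n) x * w j x) \<noteq> 0))"

end

theory Submission
  imports Defs "HOL-Real_Asymp.Real_Asymp"
begin

text \<open>
  Integrating the hypergeometric series termwise against Beta densities and summing by Gauss's theorem
  shows that the moments of the two weights are quotients of Pochhammer symbols. Against such moments,
  the polynomial \<open>3F2(-n, A, B; a, b; x)\<close> with \<open>A = c + \<lfloor>n/2\<rfloor>\<close> and \<open>B = d + \<lfloor>(n-1)/2\<rfloor>\<close> produces an
  \<open>n\<close>-th finite difference of a polynomial of degree less than \<open>n\<close>, which is the orthogonality; at the
  first index where orthogonality fails, exactly one simple pole remains, and its residue evaluates the
  integral as a product. As the orthogonality functionals are triangular with respect to \<open>P\<close>, this
  identifies \<open>P\<close>. They also reduce the recurrence to comparing three leading coefficients, which gives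
  \<open>\<beta>\<close> and \<open>\<alpha>\<close>, while \<open>\<gamma>\<close> is the ratio of two of the product evaluations.
\<close>

section \<open>Moments of the weights\<close>

text \<open>Raabe's test: \<open>n * (f n / f (n + 1) - 1)\<close> tends to
  \<open>\<gamma> + 1 - \<alpha> - \<beta>\<close>, which exceeds 1. Terminating series are split
  off because zero terms spoil the ratios; they do occur, since the second weight has the parameter
  \<open>d - (b + 1)\<close>.\<close>

lemma summable_hypergeometric_at_1:
  fixes \<alpha> \<beta> \<gamma> :: real
  assumes "\<gamma> > 0" "\<gamma> - \<alpha> - \<beta> > 0"
  shows "summable (\<lambda>n. \<bar>pochhammer \<alpha> n * pochhammer \<beta> n / (pochhammer \<gamma> n * fact n)\<bar>)"
    (is "summable ?f")
proof (cases "\<forall>n. pochhammer \<alpha> n \<noteq> 0 \<and> pochhammer \<beta> n \<noteq> 0")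
  case False
  then obtain N where N: "pochhammer \<alpha> N = 0 \<or> pochhammer \<beta> N = 0" by auto
  have "?f n = 0" if "n \<notin> {..<N}" for n
    using N pochhammer_eq_0_mono[of \<alpha> N n] pochhammer_eq_0_mono[of \<beta> N n] that by auto
  thus ?thesis by (intro summable_finite[of "{..<N}"]) auto
next
  case True
  have nz: "\<alpha> + real n \<noteq> 0" "\<beta> + real n \<noteq> 0" "\<gamma> + real n > 0" for n
    using True[rule_format, of "Suc n"] assms by (auto simp: pochhammer_Suc)
  have \<gamma>: "pochhammer \<gamma> n > 0" for n using assms by (intro pochhammer_pos)
  have pos: "?f n > 0" for n using True \<gamma>[of n] by (auto simp: less_le)
  have ratio: "?f n / ?f (Suc n) = (\<gamma> + n) * (n + 1) / (\<bar>\<alpha> + n\<bar> * \<bar>\<beta> + n\<bar>)" for n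
  proof -
    have "?f (Suc n) = ?f n * ((\<bar>\<alpha> + n\<bar> * \<bar>\<beta> + n\<bar>) / ((\<gamma> + n) * (n + 1)))"
      using nz(3)[of n] by (simp add: pochhammer_Suc abs_mult mult_ac add_ac)
    moreover have "F / (F * (X / Y)) = Y / X" if "F > 0" for F X Y :: real using that by simp
    ultimately show ?thesis using pos[of n] by presburger
  qed
  \<comment> \<open>For small \<open>n\<close> the factors \<open>\<alpha> + n\<close> and
    \<open>\<beta> + n\<close> may be negative; for large \<open>n\<close> the absolute values drop
    out.\<close>
  have ev: "eventually (\<lambda>n. real n * (?f n / ?f (Suc n) - 1) =
      real n * ((\<gamma> + n) * (n + 1) / ((\<alpha> + n) * (\<beta> + n)) - 1)) sequentially"
  proof -
    have "eventually (\<lambda>n. \<alpha> + real n > 0) sequentially" "eventually (\<lambda>n. \<beta> + real n > 0) sequentially"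
      by real_asymp+
    thus ?thesis by eventually_elim (unfold ratio, simp)
  qed
  have "(\<lambda>n. real n * ((\<gamma> + n) * (n + 1) / ((\<alpha> + n) * (\<beta> + n)) - 1)) \<longlonglongrightarrow> \<gamma> + 1 - \<alpha> - \<beta>"
    by (real_asymp simp: algebra_simps)
  hence "(\<lambda>n. real n * (?f n / ?f (Suc n) - 1)) \<longlonglongrightarrow> \<gamma> + 1 - \<alpha> - \<beta>"
    by (subst tendsto_cong[OF ev])
  hence "liminf (\<lambda>n. ereal (real n * (?f n / ?f (Suc n) - 1))) = ereal (\<gamma> + 1 - \<alpha> - \<beta>)"
    by (intro lim_imp_Liminf) (auto intro: tendsto_intros)
  thus ?thesis using assms pos
    by (intro raabes_test_convergence) (auto simp: one_ereal_def)
qed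

section \<open>Beta integrals and termwise integration\<close>

lemma Beta_real_pos: "Beta p q > (0::real)" if "p > 0" "q > 0"
  using that by (simp add: Beta_def)

lemma Beta_add_of_nat_right:
  fixes p q :: real
  assumes "p > 0" "q > 0"
  shows "Beta p (q + real n) = Beta p q * pochhammer q n / pochhammer (p + q) n"
proof -
  have "q \<notin> \<int>\<^sub>\<le>\<^sub>0" "p + q \<notin> \<int>\<^sub>\<le>\<^sub>0" using assms by (auto elim!: nonpos_Ints_cases)
  moreover have "Gamma q \<noteq> 0" "Gamma (p + q) \<noteq> 0" using assms by (simp_all add: less_imp_neq[symmetric])
  ultimately show ?thesis by (simp add: Beta_def pochhammer_Gamma field_simps)
qed

lemma Beta_lborel_Ioo:
  fixes p q :: real
  assumes "p > 0" "q > 0"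
  shows "set_integrable lborel {0<..<1} (\<lambda>x. x powr (p - 1) * (1 - x) powr (q - 1))"
    and "(LBINT x:{0<..<1}. x powr (p - 1) * (1 - x) powr (q - 1)) = Beta p q"
proof -
  show i: "set_integrable lborel {0<..<1} (\<lambda>x. x powr (p - 1) * (1 - x) powr (q - 1))"
    using integrable_Beta[OF assms] by (rule set_integrable_subset) auto
  show "(LBINT x:{0<..<1}. x powr (p - 1) * (1 - x) powr (q - 1)) = Beta p q"
    using has_integral_Beta_real[OF assms, unfolded has_integral_Icc_iff_Ioo]
      set_borel_integral_eq_integral(2)[OF i]
    by (simp add: has_integral_iff)
qed

text \<open>\<open>Beta p (q + n)\<close> decays only like a power of \<open>n\<close>, slower than
  any geometric sequence. The quotient has term ratio tending to \<open>z < 1\<close>, so it is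
  summable and hence bounded.\<close>

lemma power_bounded_by_Beta:
  fixes p q z :: real
  assumes "p > 0" "q > 0" "0 \<le> z" "z < 1"
  shows "\<exists>K. \<forall>n. z ^ n \<le> K * Beta p (q + real n)"
proof -
  let ?f = "\<lambda>n. z ^ n * pochhammer (p + q) n / pochhammer q n"
  have lim: "(\<lambda>n. z * (p + q + real n) / (q + real n)) \<longlonglongrightarrow> z"
    by real_asymp
  obtain y where y: "z < y" "y < 1" using assms dense by blast
  have "eventually (\<lambda>n. z * (p + q + real n) / (q + real n) < y) sequentially"
    using lim y(1) by (rule order_tendstoD)
  then obtain N where N: "z * (p + q + real n) / (q + real n) < y" if "n \<ge> N" for n
    by (auto simp: eventually_at_top_linorder)
  have pos: "pochhammer q n > 0" "pochhammer (p + q) n > 0" for n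
    using assms by (auto intro: pochhammer_pos)
  have "summable ?f"
  proof (rule summable_ratio_test[OF y(2)])
    fix n assume n: "n \<ge> N"
    have "?f (Suc n) = z * (p + q + real n) / (q + real n) * ?f n"
      by (simp add: pochhammer_Suc field_simps)
    also have "\<dots> \<le> y * ?f n"
      using N[OF n] assms less_imp_le[OF pos(1)[of n]] less_imp_le[OF pos(2)[of n]]
      by (intro mult_right_mono) auto
    finally show "norm (?f (Suc n)) \<le> y * norm (?f n)"
      using assms less_imp_le[OF pos(1)[of n]] less_imp_le[OF pos(2)[of n]]
        less_imp_le[OF pos(1)[of "Suc n"]] less_imp_le[OF pos(2)[of "Suc n"]]
      by (simp add: abs_mult)
  qed
  hence "Bseq ?f" by (intro convergent_imp_Bseq) (auto simp: convergent_def dest: summable_LIMSEQ_zero)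
  then obtain K where K: "\<And>n. norm (?f n) \<le> K" by (auto simp: Bseq_def)
  have "z ^ n \<le> K / Beta p q * Beta p (q + real n)" for n
    using K[of n] pos[of n] assms Beta_real_pos[of p q]
    by (simp add: Beta_add_of_nat_right field_simps abs_mult)
  thus ?thesis by blast
qed

text \<open>Absolute convergence of the integrated series already forces convergence of the power series
  on the open unit disc.\<close>

lemma Beta_integral_power_series:
  fixes h :: "nat \<Rightarrow> real"
  assumes pq: "p > 0" "q > 0" and sum: "summable (\<lambda>n. \<bar>h n\<bar> * Beta p (q + real n))"
  defines "f \<equiv> \<lambda>x. x powr (p - 1) * (1 - x) powr (q - 1) * (\<Sum>n. h n * (1 - x) ^ n)"
  shows "set_integrable lborel {0<..<1} f"
    and "(\<lambda>n. h n * Beta p (q + real n)) sums (LBINT x:{0<..<1}. f x)"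
proof -
  \<comment> \<open>With \<open>(1 - x) ^ n\<close> absorbed into the exponent, each term is a
    multiple of a Beta density, and the integral of its norm is a term of \<open>sum\<close>. This
    justifies exchanging sum and integral.\<close>
  define g where "g = (\<lambda>n x. indicator {0<..<1} x *\<^sub>R
     (h n * (x powr (p - 1) * (1 - x) powr ((q + real n) - 1))))"
  have q: "q + real n > 0" for n using pq by simp
  have conv: "summable (\<lambda>n. \<bar>h n\<bar> * (1 - x) ^ n)" if "x \<in> {0<..<1}" for x
  proof -
    have "0 \<le> 1 - x" "1 - x < 1" using that by auto
    from power_bounded_by_Beta[OF pq this]
    obtain K where K: "\<And>n. (1 - x) ^ n \<le> K * Beta p (q + real n)" by blast
    have le: "\<bar>h n\<bar> * (1 - x) ^ n \<le> K * (\<bar>h n\<bar> * Beta p (q + real n))" for n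
      using mult_left_mono[OF K[of n] abs_ge_zero[of "h n"]] by (simp only: mult.left_commute)
    show ?thesis
    proof (rule summable_comparison_test')
      show "summable (\<lambda>n. K * (\<bar>h n\<bar> * Beta p (q + real n)))"
        by (rule summable_mult[OF sum])
      show "norm (\<bar>h n\<bar> * (1 - x) ^ n) \<le> K * (\<bar>h n\<bar> * Beta p (q + real n))" if "n \<ge> 0" for n
        using le[of n] \<open>0 \<le> 1 - x\<close> by (simp only: real_norm_def abs_mult abs_idempotent power_abs abs_of_nonneg)
    qed
  qed
  have g_eq: "g n x = indicator {0<..<1} x * (x powr (p - 1) * (1 - x) powr (q - 1)) * (h n * (1 - x) ^ n)" for n x
    by (auto simp: g_def indicator_def powr_add powr_realpow[symmetric] powr_diff)
  have int: "integrable lborel (g n)" for n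
    using set_integrable_mult_right[of "h n", OF Beta_lborel_Ioo(1)[OF pq(1) q[of n]]]
    by (simp add: g_def set_integrable_def)
  have integral: "(\<integral>x. g n x \<partial>lborel) = h n * Beta p (q + real n)" for n
    using Beta_lborel_Ioo(2)[OF pq(1) q[of n]]
    unfolding g_def set_lebesgue_integral_def[symmetric] by simp
  have "(\<integral>x. norm (g n x) \<partial>lborel) = \<bar>h n\<bar> * Beta p (q + real n)" for n
  proof -
    have "(\<integral>x. norm (g n x) \<partial>lborel) = (LBINT x:{0<..<1}. \<bar>h n\<bar> * (x powr (p - 1) * (1 - x) powr ((q + real n) - 1)))"
      unfolding set_lebesgue_integral_def g_def by (intro Bochner_Integration.integral_cong) (auto simp: abs_mult indicator_def)
    thus ?thesis using Beta_lborel_Ioo(2)[OF pq(1) q[of n]] by simp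
  qed
  hence sum': "summable (\<lambda>n. \<integral>x. norm (g n x) \<partial>lborel)" using sum by simp
  have AE: "AE x in lborel. summable (\<lambda>n. norm (g n x))"
  proof (rule AE_I2)
    fix x :: real
    show "summable (\<lambda>n. norm (g n x))"
    proof (cases "x \<in> {0<..<1}")
      case True
      thus ?thesis using summable_mult[OF conv[OF True], of "x powr (p - 1) * (1 - x) powr (q - 1)"]
        by (simp add: g_eq abs_mult)
    qed (simp add: g_eq)
  qed
  have lim: "(\<lambda>x. \<Sum>n. g n x) = (\<lambda>x. indicator {0<..<1} x *\<^sub>R f x)"
  proof
    fix x :: real
    show "(\<Sum>n. g n x) = indicator {0<..<1} x *\<^sub>R f x"
    proof (cases "x \<in> {0<..<1}")
      case True
      have "summable (\<lambda>n. h n * (1 - x) ^ n)"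
        using conv[OF True] True by (intro summable_rabs_cancel[of "\<lambda>n. h n * (1 - x) ^ n"]) (simp add: abs_mult)
      thus ?thesis using True by (simp add: g_eq f_def suminf_mult)
    qed (simp add: g_eq)
  qed
  show "set_integrable lborel {0<..<1} f"
    using integrable_suminf[OF int AE sum'] by (simp add: lim set_integrable_def)
  show "(\<lambda>n. h n * Beta p (q + real n)) sums (LBINT x:{0<..<1}. f x)"
    using sums_integral[OF int AE sum'] by (simp add: lim integral set_lebesgue_integral_def)
qed

text \<open>Newton's binomial series for the base \<open>1 + (x - 1)\<close> and the exponent
  \<open>- \<alpha>\<close>.\<close>

lemma pochhammer_binomial_series:
  fixes \<alpha> x :: real
  assumes "x \<in> {0<..<1}"
  shows "(\<Sum>n. pochhammer \<alpha> n / fact n * (1 - x) ^ n) = x powr (- \<alpha>)"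
proof -
  have "pochhammer \<alpha> n / fact n * (1 - x) ^ n = ((- \<alpha>) gchoose n) * (x - 1) ^ n" for n
    by (simp add: gbinomial_pochhammer power_mult_distrib[symmetric] mult_ac)
  thus ?thesis using gen_binomial_real[of "x - 1" "- \<alpha>"] assms by (simp add: sums_iff)
qed

text \<open>Euler's integral at argument 1: expanding \<open>x powr (- \<alpha>)\<close> in powers
  of \<open>1 - x\<close> inside a Beta integral and integrating termwise gives the series, while
  the unexpanded integral is \<open>Beta (\<gamma> - \<alpha> - \<beta>) \<beta>\<close>.\<close>

lemma Gauss_hypergeometric_sums:
  fixes \<alpha> \<beta> \<gamma> :: real
  assumes \<beta>: "0 < \<beta>" "\<beta> < \<gamma>" and \<gamma>: "\<gamma> - \<alpha> - \<beta> > 0"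
  shows "(\<lambda>n. pochhammer \<alpha> n * pochhammer \<beta> n / (pochhammer \<gamma> n * fact n)) sums
           (Gamma \<gamma> * Gamma (\<gamma> - \<alpha> - \<beta>) / (Gamma (\<gamma> - \<alpha>) * Gamma (\<gamma> - \<beta>)))"
proof -
  define h where "h = (\<lambda>n. pochhammer \<alpha> n / fact n)"
  have B: "Beta (\<gamma> - \<beta>) (\<beta> + real n) = Beta (\<gamma> - \<beta>) \<beta> * (pochhammer \<beta> n / pochhammer \<gamma> n)" for n
    using Beta_add_of_nat_right[of "\<gamma> - \<beta>" \<beta> n] assms by simp
  have pos: "pochhammer \<beta> n > 0" "pochhammer \<gamma> n > 0" "Beta (\<gamma> - \<beta>) \<beta> > 0" for n
    using assms by (auto intro: pochhammer_pos Beta_real_pos)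
  have "summable (\<lambda>n. Beta (\<gamma> - \<beta>) \<beta> * \<bar>pochhammer \<alpha> n * pochhammer \<beta> n / (pochhammer \<gamma> n * fact n)\<bar>)"
    using assms by (intro summable_mult summable_hypergeometric_at_1) auto
  hence "summable (\<lambda>n. \<bar>h n\<bar> * Beta (\<gamma> - \<beta>) (\<beta> + real n))"
    unfolding B h_def by (simp add: abs_mult abs_of_pos[OF pos(1)] abs_of_pos[OF pos(2)] mult_ac)
  from Beta_integral_power_series(2)[OF _ _ this]
  have sums: "(\<lambda>n. h n * Beta (\<gamma> - \<beta>) (\<beta> + real n)) sums
      (LBINT x:{0<..<1}. x powr ((\<gamma> - \<beta>) - 1) * (1 - x) powr (\<beta> - 1) * (\<Sum>n. h n * (1 - x) ^ n))"
    using assms by simp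
  have eq: "x powr ((\<gamma> - \<beta>) - 1) * (1 - x) powr (\<beta> - 1) * (\<Sum>n. h n * (1 - x) ^ n) =
      x powr ((\<gamma> - \<alpha> - \<beta>) - 1) * (1 - x) powr (\<beta> - 1)" if "x \<in> {0<..<1}" for x
    unfolding h_def pochhammer_binomial_series[OF that]
    using powr_add[of x "(\<gamma> - \<beta>) - 1" "- \<alpha>"] by (simp add: algebra_simps)
  note sums
  also have "(LBINT x:{0<..<1}. x powr ((\<gamma> - \<beta>) - 1) * (1 - x) powr (\<beta> - 1) * (\<Sum>n. h n * (1 - x) ^ n))
     = (LBINT x:{0<..<1}. x powr ((\<gamma> - \<alpha> - \<beta>) - 1) * (1 - x) powr (\<beta> - 1))"
    by (intro set_lebesgue_integral_cong allI impI eq) auto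
  also have "\<dots> = Beta (\<gamma> - \<alpha> - \<beta>) \<beta>" using assms by (intro Beta_lborel_Ioo)
  finally have "(\<lambda>n. h n * Beta (\<gamma> - \<beta>) (\<beta> + real n) / Beta (\<gamma> - \<beta>) \<beta>) sums
     (Beta (\<gamma> - \<alpha> - \<beta>) \<beta> / Beta (\<gamma> - \<beta>) \<beta>)"
    by (rule sums_divide)
  moreover have "Beta (\<gamma> - \<alpha> - \<beta>) \<beta> / Beta (\<gamma> - \<beta>) \<beta> =
     Gamma \<gamma> * Gamma (\<gamma> - \<alpha> - \<beta>) / (Gamma (\<gamma> - \<alpha>) * Gamma (\<gamma> - \<beta>))"
    using Gamma_real_pos[OF \<beta>(1)] by (simp add: Beta_def)
  moreover have "h n * Beta (\<gamma> - \<beta>) (\<beta> + real n) / Beta (\<gamma> - \<beta>) \<beta> =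
      pochhammer \<alpha> n * pochhammer \<beta> n / (pochhammer \<gamma> n * fact n)" for n
    unfolding B h_def using pos(3) by (simp add: field_simps)
  ultimately show ?thesis by simp
qed

text \<open>Termwise integration of the 2F1 against \<open>x powr (a + m - 1)\<close> and
  \<open>(1 - x) powr (\<delta> - 1)\<close> replaces its lower parameter \<open>\<delta>\<close> by
  \<open>a + m + \<delta>\<close> and its argument by 1, so Gauss's theorem applies.\<close>

lemma weight_moment:
  fixes a b c d :: real
  assumes pos: "a > 0" "b > 0" "c > 0" "d > 0" and bc: "b < c" and \<delta>: "a + b < c + d"
  shows "set_integrable lborel {0<..<1} (\<lambda>x. x ^ m * weight a b c d x)"
    and "(LBINT x:{0<..<1}. x ^ m * weight a b c d x) =
           pochhammer a m * pochhammer b m / (pochhammer c m * pochhammer d m)"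
proof -
  define \<delta> where "\<delta> = c + d - a - b"
  define C where "C = Gamma c * Gamma d / (Gamma a * Gamma b * Gamma \<delta>)"
  define h where "h = (\<lambda>n. pochhammer (c - b) n * pochhammer (d - b) n / pochhammer \<delta> n / fact n)"
  define \<gamma> where "\<gamma> = a + real m + \<delta>"
  have pq: "a + real m > 0" "\<delta> > 0" "\<gamma> > 0" using pos \<delta> by (auto simp: \<delta>_def \<gamma>_def add_pos_nonneg)
  have pp: "pochhammer \<delta> n > 0" "pochhammer \<gamma> n > 0" for n
    using pq by (auto intro: pochhammer_pos)
  \<comment> \<open>The factor \<open>pochhammer \<delta> n\<close> cancels. The parameter
    \<open>d - b\<close>, whose sign is not controlled, takes the place of \<open>\<alpha>\<close>
    in Gauss's theorem; \<open>c - b > 0\<close> takes that of \<open>\<beta>\<close>.\<close>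
  have hB: "h n * Beta (a + real m) (\<delta> + real n) =
     Beta (a + real m) \<delta> * (pochhammer (d - b) n * pochhammer (c - b) n / (pochhammer \<gamma> n * fact n))" for n
    using pp[of n] Beta_add_of_nat_right[OF pq(1,2), of n] by (simp add: h_def \<gamma>_def field_simps)
  have "\<bar>h n\<bar> * Beta (a + real m) (\<delta> + real n) =
     Beta (a + real m) \<delta> * \<bar>pochhammer (d - b) n * pochhammer (c - b) n / (pochhammer \<gamma> n * fact n)\<bar>" for n
  proof -
    have "\<bar>h n\<bar> * Beta (a + real m) (\<delta> + real n) = \<bar>h n * Beta (a + real m) (\<delta> + real n)\<bar>"
      using Beta_real_pos[OF pq(1), of "\<delta> + real n"] pq by (simp add: abs_mult)
    thus ?thesis using Beta_real_pos[OF pq(1,2)] unfolding hB by (simp add: abs_mult)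
  qed
  moreover have g2: "\<gamma> - (d - b) - (c - b) > 0"
    using pos by (simp add: \<gamma>_def \<delta>_def)
  ultimately have sum: "summable (\<lambda>n. \<bar>h n\<bar> * Beta (a + real m) (\<delta> + real n))"
    using summable_mult[OF summable_hypergeometric_at_1[OF pq(3) g2]] by simp
  define f where "f = (\<lambda>x. x powr (a + real m - 1) * (1 - x) powr (\<delta> - 1) * (\<Sum>n. h n * (1 - x) ^ n))"
  note int = Beta_integral_power_series[OF pq(1,2) sum, folded f_def]
  have w: "x ^ m * weight a b c d x = C * f x" if "x \<in> {0<..<1}" for x
    using that by (simp add: weight_def Let_def hyp2F1_def f_def C_def \<delta>_def[symmetric] h_def
       powr_add powr_diff powr_realpow mult_ac)
  have "set_integrable lborel {0<..<1} (\<lambda>x. C * f x)"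
    using int(1) by simp
  thus "set_integrable lborel {0<..<1} (\<lambda>x. x ^ m * weight a b c d x)"
    by (rule set_integrable_cong[THEN iffD1, rotated -1]) (auto simp: w)
  have G: "Gamma (a + real m) > 0" "Gamma (b + real m) > 0" "Gamma (c + real m) > 0" 
     "Gamma (d + real m) > 0" "Gamma a > 0" "Gamma b > 0" "Gamma c > 0" "Gamma d > 0" "Gamma \<delta> > 0" "Gamma \<gamma> > 0"
    using pos pq by (auto intro!: Gamma_real_pos add_pos_nonneg)
  have "(\<lambda>n. h n * Beta (a + real m) (\<delta> + real n)) sums (Beta (a + real m) \<delta> *
      (Gamma \<gamma> * Gamma (\<gamma> - (d - b) - (c - b)) / (Gamma (\<gamma> - (d - b)) * Gamma (\<gamma> - (c - b)))))"
    unfolding hB using bc pos g2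
    by (intro sums_mult Gauss_hypergeometric_sums) (auto simp: \<gamma>_def \<delta>_def)
  also have "\<gamma> - (d - b) - (c - b) = b + real m" by (simp add: \<gamma>_def \<delta>_def)
  also have "\<gamma> - (d - b) = c + real m" by (simp add: \<gamma>_def \<delta>_def)
  also have "\<gamma> - (c - b) = d + real m" by (simp add: \<gamma>_def \<delta>_def)
  finally have "(LBINT x:{0<..<1}. f x) = Beta (a + real m) \<delta> *
      (Gamma \<gamma> * Gamma (b + real m) / (Gamma (c + real m) * Gamma (d + real m)))"
    using int(2) sums_unique2 by blast
  also have "\<dots> = Gamma (a + real m) * Gamma \<delta> * Gamma (b + real m) / (Gamma (c + real m) * Gamma (d + real m))"
    using G by (simp add: Beta_def \<gamma>_def)
  finally have F: "(LBINT x:{0<..<1}. f x) = \<dots>" .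
  have np: "a \<notin> \<int>\<^sub>\<le>\<^sub>0" "b \<notin> \<int>\<^sub>\<le>\<^sub>0" "c \<notin> \<int>\<^sub>\<le>\<^sub>0" "d \<notin> \<int>\<^sub>\<le>\<^sub>0" using pos by (auto elim!: nonpos_Ints_cases)
  have "(LBINT x:{0<..<1}. x ^ m * weight a b c d x) = (LBINT x:{0<..<1}. C * f x)"
    by (intro set_lebesgue_integral_cong) (auto simp: w)
  also have "\<dots> = C * (LBINT x:{0<..<1}. f x)" by simp
  also have "\<dots> = pochhammer a m * pochhammer b m / (pochhammer c m * pochhammer d m)"
    using G np by (simp add: F C_def pochhammer_Gamma field_simps)
  finally show "(LBINT x:{0<..<1}. x ^ m * weight a b c d x) = \<dots>" .
qed

section \<open>Finite differences and terminating series\<close>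

text \<open>Pascal's rule. Up to sign the sum is an iterated forward difference of \<open>g\<close>
  at 0, and one difference is carried out here.\<close>

lemma alternating_binomial_sum_Suc:
  fixes g :: "nat \<Rightarrow> 'a::comm_ring_1"
  shows "(\<Sum>i\<le>Suc n. (-1) ^ i * of_nat (Suc n choose i) * g i) =
         (\<Sum>i\<le>n. (-1) ^ i * of_nat (n choose i) * (g i - g (Suc i)))"
proof -
  have "(\<Sum>i\<le>n. (-1) ^ i * of_nat (n choose i) * g i) = (\<Sum>i\<le>Suc n. (-1) ^ i * of_nat (n choose i) * g i)"
    by (simp add: binomial_eq_0)
  also have "\<dots> = g 0 - (\<Sum>i\<le>n. (-1) ^ i * of_nat (n choose Suc i) * g (Suc i))"
    by (subst sum.atMost_Suc_shift) (simp add: sum_negf)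
  finally have "(\<Sum>i\<le>n. (-1) ^ i * of_nat (n choose i) * g i) = \<dots>" .
  thus ?thesis
    by (subst sum.atMost_Suc_shift) (simp add: algebra_simps sum.distrib sum_subtractf sum_negf)
qed

text \<open>Each difference lowers the degree, because \<open>p\<close> and its shift share the
  leading coefficient; a constant is sent to 0.\<close>

lemma alternating_binomial_sum_poly_eq_0:
  fixes p :: "'a::idom poly"
  assumes "degree p < n"
  shows "(\<Sum>i\<le>n. (-1) ^ i * of_nat (n choose i) * poly p (of_nat i)) = 0"
  using assms
proof (induction n arbitrary: p)
  case (Suc n)
  define q where "q = p - pcompose p [:1, 1:]"
  have "(\<Sum>i\<le>Suc n. (-1) ^ i * of_nat (Suc n choose i) * poly p (of_nat i)) =
        (\<Sum>i\<le>n. (-1) ^ i * of_nat (n choose i) * poly q (of_nat i))"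
    unfolding alternating_binomial_sum_Suc by (simp add: q_def poly_pcompose)
  also have "\<dots> = 0"
  proof (cases "degree p = 0")
    case True
    then obtain x where "p = [:x:]" by (rule degree_eq_zeroE)
    thus ?thesis by (simp add: q_def pcompose_pCons)
  next
    case False
    have "degree (pcompose p [:1, 1:]) = degree p" by (simp add: degree_pcompose)
    hence "degree q \<le> degree p" "coeff q (degree p) = 0"
      using lead_coeff_comp[of "[:1, 1:]" p] by (auto simp: q_def degree_diff_le)
    hence "q = 0 \<or> degree q < degree p" by (rule eq_zero_or_degree_less)
    thus ?thesis using Suc.IH[of q] Suc.prems by auto
  qed
  finally show ?case .
qed simp

text \<open>The partial fraction decomposition of the right-hand side. The induction needs arbitrary
  \<open>z\<close>, as the difference step also produces \<open>z + 1\<close>.\<close>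

lemma alternating_binomial_sum_inverse:
  fixes z :: real
  assumes "z > 0"
  shows "(\<Sum>i\<le>n. (-1) ^ i * of_nat (n choose i) * (1 / (z + of_nat i))) = fact n / pochhammer z (Suc n)"
  using assms
proof (induction n arbitrary: z)
  case (Suc n)
  have "(\<Sum>i\<le>Suc n. (-1) ^ i * of_nat (Suc n choose i) * (1 / (z + of_nat i))) =
     (\<Sum>i\<le>n. (-1) ^ i * of_nat (n choose i) * (1 / (z + of_nat i))) -
     (\<Sum>i\<le>n. (-1) ^ i * of_nat (n choose i) * (1 / ((z + 1) + of_nat i)))"
    unfolding alternating_binomial_sum_Suc by (simp add: sum_subtractf algebra_simps)
  also have "\<dots> = fact n / pochhammer z (Suc n) - fact n / pochhammer (z + 1) (Suc n)"
    using Suc.prems by (simp only: Suc.IH)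
  also have "\<dots> = fact (Suc n) / pochhammer z (Suc (Suc n))"
  proof -
    have z: "pochhammer z (Suc n) = z * pochhammer (z + 1) n"
      "pochhammer z (Suc (Suc n)) = z * (pochhammer (z + 1) n * (z + 1 + real n))"
      "pochhammer (z + 1) (Suc n) = pochhammer (z + 1) n * (z + 1 + real n)"
      by (simp_all only: pochhammer_rec[of z] pochhammer_Suc[of "z + 1"])
    have "pochhammer (z + 1) n > 0" "z + 1 + real n > 0" using Suc.prems by (auto intro: pochhammer_pos)
    thus ?thesis unfolding z using Suc.prems by (simp add: divide_simps) (simp add: algebra_simps)
  qed
  finally show ?case .
qed simp

text \<open>Division of \<open>p\<close> by the linear factor: the quotient has degree below
  \<open>n\<close> and is annihilated by the difference, so only the remainder
  \<open>poly p (-z)\<close>, the residue at the pole, survives.\<close>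

lemma alternating_binomial_sum_poly_div:
  fixes z :: real
  assumes "z > 0" and "degree p \<le> n"
  shows "(\<Sum>i\<le>n. (-1) ^ i * of_nat (n choose i) * (poly p (of_nat i) / (z + of_nat i))) =
         poly p (-z) * fact n / pochhammer z (Suc n)"
proof -
  define q where "q = synthetic_div p (-z)"
  have p: "p = [:z, 1:] * q + [:poly p (-z):]"
    using synthetic_div_correct'[of "-z" p] by (simp add: q_def)
  have "(\<Sum>i\<le>n. (-1) ^ i * of_nat (n choose i) * poly q (of_nat i)) = 0"
  \<comment> \<open>For constant \<open>p\<close> the quotient is 0; this covers
    \<open>n = 0\<close>, where no degree lies below \<open>n\<close>.\<close>
  proof (cases "degree p = 0")
    case True
    then obtain x where "p = [:x:]" by (rule degree_eq_zeroE)
    thus ?thesis by (simp add: q_def)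
  next
    case False
    thus ?thesis using assms
      by (intro alternating_binomial_sum_poly_eq_0) (simp add: q_def degree_synthetic_div)
  qed
  moreover have "poly p (of_nat i) / (z + of_nat i) = poly q (of_nat i) + poly p (-z) * (1 / (z + of_nat i))" for i
  proof -
    have "poly p (of_nat i) = (z + of_nat i) * poly q (of_nat i) + poly p (-z)"
      by (subst p) (simp add: algebra_simps)
    moreover have "z + of_nat i > 0" using assms by simp
    ultimately show ?thesis by (simp add: field_simps)
  qed
  ultimately have "(\<Sum>i\<le>n. (-1) ^ i * of_nat (n choose i) * (poly p (of_nat i) / (z + of_nat i))) =
     poly p (-z) * (\<Sum>i\<le>n. (-1) ^ i * of_nat (n choose i) * (1 / (z + of_nat i)))"
    by (simp add: algebra_simps sum.distrib sum_distrib_left)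
  thus ?thesis using alternating_binomial_sum_inverse[OF assms(1), of n] by simp
qed

section \<open>Pochhammer symbols and their quotients as functions of the index\<close>

lemma poly_pochhammer: "poly (pochhammer p n) x = pochhammer (poly p x) n"
  by (induction n) (simp_all add: pochhammer_Suc)

lemma degree_pochhammer_linear_le: "degree (pochhammer [:x, 1:] n) \<le> n"
proof (induction n)
  case (Suc n)
  have "[:x, 1:] + of_nat n = [:x + of_nat n, 1:]" by (simp add: of_nat_poly)
  thus ?case using Suc degree_mult_le[of "pochhammer [:x, 1:] n" "[:x + of_nat n, 1:]"]
    by (simp add: pochhammer_Suc)
qed simp

text \<open>The factors of the later summands as functions of \<open>i\<close>: the first and third
  quotients are polynomials, of degrees \<open>s - m\<close> and \<open>m\<close>; the second, where
  the shift exceeds \<open>s\<close> by one, has a single simple pole.\<close>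

lemma pochhammer_shift_quotient:
  fixes z :: real
  assumes "z > 0"
  shows "m \<le> s \<Longrightarrow> pochhammer (z + real s) i / pochhammer z (i + m) =
           pochhammer (z + real m + real i) (s - m) / pochhammer z s"
    and "pochhammer (z + real s) i / pochhammer z (i + Suc s) =
           1 / (pochhammer z s * (z + real s + real i))"
    and "pochhammer z (i + m) / pochhammer z i = pochhammer (z + real i) m"
proof -
  have pos: "pochhammer z k > 0" for k using assms by (rule pochhammer_pos)
  have 1: "pochhammer z s * pochhammer (z + real s) i = pochhammer z (s + i)"
    by (simp add: pochhammer_product')
  show "pochhammer z (i + m) / pochhammer z i = pochhammer (z + real i) m"
    using pos[of i] by (simp add: pochhammer_product')
  show "pochhammer (z + real s) i / pochhammer z (i + m) =
           pochhammer (z + real m + real i) (s - m) / pochhammer z s" if "m \<le> s"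
  proof -
    have "pochhammer z (s + i) = pochhammer z (i + m) * pochhammer (z + real m + real i) (s - m)"
      using that pochhammer_product[of "i + m" "s + i" z] by (simp add: add_ac)
    with 1 show ?thesis using pos[of s] pos[of "i + m"] by (simp add: field_simps)
  qed
  have "pochhammer z (i + Suc s) = pochhammer z s * pochhammer (z + real s) i * (z + real s + real i)"
    unfolding 1 by (simp add: pochhammer_Suc add_ac)
  moreover have "pochhammer (z + real s) i > 0" using assms by (intro pochhammer_pos) simp
  ultimately show "pochhammer (z + real s) i / pochhammer z (i + Suc s) =
           1 / (pochhammer z s * (z + real s + real i))"
    by simp
qed

text \<open>Reverses the order of the factors and flips their signs; this brings the residues into
  closed form.\<close>

lemma pochhammer_reflect: "pochhammer (- (y::real) - real k + 1) k = (-1) ^ k * pochhammer y k"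
  using pochhammer_minus[of "y + real k - 1" k] by (simp add: algebra_simps)

text \<open>The monic multiple of the terminating series \<open>3F2(-n, A, B; a, b; x)\<close>.\<close>

definition hyp3F2_poly :: "real \<Rightarrow> real \<Rightarrow> real \<Rightarrow> real \<Rightarrow> nat \<Rightarrow> real poly" where
  "hyp3F2_poly a b A B n = (\<Sum>i\<le>n. monom ((-1) ^ (n - i) * real (n choose i) *
     (pochhammer (a + real i) (n - i) * pochhammer (b + real i) (n - i)) /
     (pochhammer (A + real i) (n - i) * pochhammer (B + real i) (n - i))) i)"

section \<open>Coefficients of the monic 3F2 polynomials\<close>

lemma coeff_hyp3F2_poly:
  "coeff (hyp3F2_poly a b A B n) i = (if i \<le> n then (-1) ^ (n - i) * real (n choose i) *
     (pochhammer (a + real i) (n - i) * pochhammer (b + real i) (n - i)) /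
     (pochhammer (A + real i) (n - i) * pochhammer (B + real i) (n - i)) else 0)"
  by (simp add: hyp3F2_poly_def coeff_sum if_distrib if_distribR cong: if_cong)

lemma coeff_hyp3F2_poly_top [simp]: "coeff (hyp3F2_poly a b A B n) n = 1"
  by (simp add: coeff_hyp3F2_poly)

lemma degree_hyp3F2_poly [simp]: "degree (hyp3F2_poly a b A B n) = n"
proof (rule antisym)
  show "degree (hyp3F2_poly a b A B n) \<le> n" by (intro degree_le) (auto simp: coeff_hyp3F2_poly)
  show "n \<le> degree (hyp3F2_poly a b A B n)" by (intro le_degree) simp
qed

lemma hyp3F2_poly_commute: "hyp3F2_poly a b A B n = hyp3F2_poly a b B A n"
  by (simp add: hyp3F2_poly_def mult_ac)

lemma coeff_hyp3F2_poly_second: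
  "coeff (hyp3F2_poly a b A B (Suc l)) l =
     - ((real l + 1) * (a + real l) * (b + real l) / ((A + real l) * (B + real l)))"
proof -
  have "Suc l - l = 1" "real (Suc l choose l) = real l + 1" by simp_all
  thus ?thesis unfolding coeff_hyp3F2_poly
    by (simp only: le_SucI order_refl if_True mult_1_left power_one_right pochhammer_1 mult_minus1 mult.assoc
      minus_mult_left[symmetric] minus_divide_left[symmetric])
qed

lemma coeff_hyp3F2_poly_third:
  "coeff (hyp3F2_poly a b A B (Suc (Suc l))) l =
     ((real l + 2) * (a + real l + 1) * (b + real l + 1)) * ((real l + 1) * (a + real l) * (b + real l)) /
     (2 * ((A + real l) * (A + real l + 1) * (B + real l) * (B + real l + 1)))"
proof -
  have "Suc (Suc l) choose l = Suc (Suc l) choose 2"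
    using binomial_symmetric[of l "Suc (Suc l)"] by simp
  hence ch: "real (Suc (Suc l) choose l) = (real l + 2) * (real l + 1) / 2"
    by (simp add: choose_two real_of_nat_div algebra_simps)
  have "Suc (Suc l) - l = 2" by simp
  thus ?thesis unfolding coeff_hyp3F2_poly ch
    by (simp add: pochhammer_Suc numeral_2_eq_2[symmetric] power2_eq_square)
       (simp add: numeral_2_eq_2 pochhammer_Suc mult_ac)
qed

text \<open>Returns from the monic normalisation to the series, the form in which the Pochhammer
  symbols can be paired with those of the moments.\<close>

lemma coeff_hyp3F2_poly_series:
  assumes "a > 0" "b > 0" "A > 0" "B > 0" "i \<le> n"
  shows "coeff (hyp3F2_poly a b A B n) i =
     (-1) ^ n * pochhammer a n * pochhammer b n / (pochhammer A n * pochhammer B n) *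
     ((-1) ^ i * real (n choose i) * (pochhammer A i * pochhammer B i / (pochhammer a i * pochhammer b i)))"
proof -
  have pos: "pochhammer z k > 0" if "z > 0" for z :: real and k using that by (rule pochhammer_pos)
  have *: "pochhammer z n = pochhammer z i * pochhammer (z + real i) (n - i)" for z :: real
    using assms by (intro pochhammer_product) auto
  have sgn: "(-1::real) ^ (n - i) = (-1) ^ n * (-1) ^ i"
    using assms by (metis (no_types) le_add_diff_inverse2 minus_one_power_iff even_add mult_minus_left mult_minus_right mult_1 add.inverse_inverse)
  show ?thesis
    unfolding *[of a] *[of b] *[of A] *[of B] coeff_hyp3F2_poly
    using assms pos[OF assms(1), of i] pos[OF assms(2), of i] pos[OF assms(3), of i] pos[OF assms(4), of i]
    by (simp add: sgn)
qed

section \<open>Functionals given by moments\<close>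

definition moment_functional :: "(nat \<Rightarrow> real) \<Rightarrow> real poly \<Rightarrow> real" where
  "moment_functional \<mu> p = (\<Sum>i\<le>degree p. coeff p i * \<mu> i)"

lemma moment_functional_eq_sum:
  assumes "degree p \<le> N"
  shows "moment_functional \<mu> p = (\<Sum>i\<le>N. coeff p i * \<mu> i)"
  unfolding moment_functional_def using assms
  by (intro sum.mono_neutral_left) (auto simp: coeff_eq_0)

lemma moment_functional_add: "moment_functional \<mu> (p + q) = moment_functional \<mu> p + moment_functional \<mu> q"
proof -
  define N where "N = max (degree p) (degree q)"
  have "degree p \<le> N" "degree q \<le> N" "degree (p + q) \<le> N"
    by (auto simp: N_def degree_add_le_max)
  thus ?thesis by (simp add: moment_functional_eq_sum[of _ N] sum.distrib algebra_simps)
qed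

lemma moment_functional_smult: "moment_functional \<mu> (smult r p) = r * moment_functional \<mu> p"
  by (simp add: moment_functional_eq_sum[OF degree_smult_le] moment_functional_def sum_distrib_left mult_ac)

lemma moment_functional_diff: "moment_functional \<mu> (p - q) = moment_functional \<mu> p - moment_functional \<mu> q"
  using moment_functional_add[of \<mu> p "- q"] moment_functional_smult[of \<mu> "-1" q] by simp

lemma moment_functional_pCons_0: "moment_functional \<mu> (pCons 0 p) = moment_functional (\<lambda>i. \<mu> (Suc i)) p"
proof (cases "p = 0")
  case False
  thus ?thesis unfolding moment_functional_def by (simp add: degree_pCons_eq sum.atMost_Suc_shift del: sum.atMost_Suc)
qed (simp add: moment_functional_def)

text \<open>Leading terms are stripped one at a time. Bounding \<open>R\<close> by its coefficients
  instead of its degree makes \<open>n = 0\<close> mean \<open>R = 0\<close>.\<close>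

lemma monic_basis_expansion:
  fixes P :: "nat \<Rightarrow> 'a::comm_ring_1 poly"
  assumes P: "\<And>n. degree (P n) = n" "\<And>n. lead_coeff (P n) = 1"
    and R: "\<And>i. i \<ge> n \<Longrightarrow> coeff R i = 0"
  shows "\<exists>r. R = (\<Sum>l<n. smult (r l) (P l))"
  using R
proof (induction n arbitrary: R)
  case (Suc n)
  define x where "x = coeff R n"
  have "coeff (R - smult x (P n)) i = 0" if "i \<ge> n" for i
    using Suc.prems[of i] that P[of n] by (cases "i = n") (auto simp: x_def coeff_eq_0)
  from Suc.IH[OF this] obtain r where r: "R - smult x (P n) = (\<Sum>l<n. smult (r l) (P l))" by blast
  have "R = (\<Sum>l<Suc n. smult ((r(n := x)) l) (P l))"
    using r by (simp add: algebra_simps)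
  thus ?case by blast
qed (auto intro: poly_eqI)

text \<open>The functionals are triangular with respect to \<open>P\<close>, so the coefficients of \<open>R\<close> in the
  basis \<open>P\<close> vanish one after the other, lowest index first.\<close>

lemma triangular_functionals_imp_zero:
  fixes P :: "nat \<Rightarrow> real poly" and L :: "nat \<Rightarrow> nat \<Rightarrow> real"
  assumes P: "\<And>n. degree (P n) = n" "\<And>n. lead_coeff (P n) = 1"
    and L: "\<And>m n. m < n \<Longrightarrow> moment_functional (L m) (P n) = 0"
           "\<And>n. moment_functional (L n) (P n) \<noteq> 0"
    and R: "\<And>i. i \<ge> n \<Longrightarrow> coeff R i = 0"
           "\<And>m. m < n \<Longrightarrow> moment_functional (L m) R = 0"
  shows "R = 0"
proof -
  have L_sum: "moment_functional \<mu> (\<Sum>l\<in>A. smult (r l) (P l)) = (\<Sum>l\<in>A. r l * moment_functional \<mu> (P l))"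
    if "finite A" for \<mu> r and A :: "nat set"
    using that
  proof induction
    case empty
    show ?case by (simp add: moment_functional_def)
  qed (simp add: moment_functional_add moment_functional_smult)
  obtain r where r: "R = (\<Sum>l<n. smult (r l) (P l))"
    using monic_basis_expansion[of P n R] P R(1) by blast
  have "r m = 0" if "m < n" for m
    using that
  proof (induction m rule: less_induct)
    case (less m)
    \<comment> \<open>Terms with \<open>l < m\<close> vanish by the induction hypothesis, those with
      \<open>l > m\<close> by triangularity.\<close>
    have "r l * moment_functional (L m) (P l) = 0" if "l \<in> {..<n} - {m}" for l
      using that less.IH[of l] less.prems L(1)[of m l] by (cases "l < m") auto
    hence "(\<Sum>l\<in>{..<n} - {m}. r l * moment_functional (L m) (P l)) = 0"
      by (intro sum.neutral ballI)
    hence "(\<Sum>l<n. r l * moment_functional (L m) (P l)) = r m * moment_functional (L m) (P m)"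
      using less.prems by (subst sum.remove[of _ m]) simp_all
    moreover have "(\<Sum>l<n. r l * moment_functional (L m) (P l)) = 0"
      using R(2)[OF less.prems] L_sum[of "{..<n}" "L m" r] r by simp
    ultimately show ?case using L(2)[of m] by simp
  qed
  thus ?thesis by (simp add: r)
qed

text \<open>For \<open>m = 2 * k + j\<close> with \<open>j < 2\<close>, this is the moment of order \<open>k + i\<close> of the \<open>j\<close>-th weight;
  the two moment sequences are unified through
  \<open>pochhammer (z + 1) n = pochhammer z (n + 1) / z\<close>.\<close>

definition weight_moments :: "real \<Rightarrow> real \<Rightarrow> real \<Rightarrow> real \<Rightarrow> nat \<Rightarrow> nat \<Rightarrow> real" where
  "weight_moments a b c d m i = (c / b) ^ (m mod 2) *
     (pochhammer a (i + m div 2) * pochhammer b (i + (m + 1) div 2) /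
      (pochhammer c (i + (m + 1) div 2) * pochhammer d (i + m div 2)))"

section \<open>Values of the functionals on the 3F2 polynomials\<close>

context
  fixes a b c d :: real
  assumes pos: "a > 0" "b > 0" "c > 0" "d > 0"
begin

text \<open>Coefficient times moment, with factors paired by base \<open>a\<close>,
  \<open>b\<close>, \<open>c\<close>, \<open>d\<close>. Free \<open>s\<close> and \<open>t\<close>
  let the vanishing result and both diagonal evaluations share this finite difference.\<close>

lemma functional_hyp3F2_poly:
  fixes n m s t :: nat
  defines "K \<equiv> (c / b) ^ (m mod 2) * ((-1) ^ n * pochhammer a n * pochhammer b n /
     (pochhammer (c + real s) n * pochhammer (d + real t) n))"
  shows "moment_functional (weight_moments a b c d m) (hyp3F2_poly a b (c + real s) (d + real t) n) =
    K * (\<Sum>i\<le>n. (-1) ^ i * of_nat (n choose i) *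
      (pochhammer (a + real i) (m div 2) * pochhammer (b + real i) ((m + 1) div 2) *
       (pochhammer (c + real s) i / pochhammer c (i + (m + 1) div 2)) *
       (pochhammer (d + real t) i / pochhammer d (i + m div 2))))"
proof -
  have A: "c + real s > 0" "d + real t > 0" using pos by auto
  have "coeff (hyp3F2_poly a b (c + real s) (d + real t) n) i * weight_moments a b c d m i =
     K * ((-1) ^ i * of_nat (n choose i) *
      (pochhammer (a + real i) (m div 2) * pochhammer (b + real i) ((m + 1) div 2) *
       (pochhammer (c + real s) i / pochhammer c (i + (m + 1) div 2)) *
       (pochhammer (d + real t) i / pochhammer d (i + m div 2))))" if "i \<le> n" for i
    unfolding coeff_hyp3F2_poly_series[OF pos(1,2) A that] weight_moments_def K_def
      pochhammer_shift_quotient(3)[OF pos(1), symmetric] pochhammer_shift_quotient(3)[OF pos(2), symmetric]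
    by (simp add: mult_ac)
  thus ?thesis by (simp add: moment_functional_def sum_distrib_left)
qed

text \<open>For \<open>m < n\<close> the shifts of \<open>c\<close> and \<open>d\<close> in the
  moments do not exceed \<open>s\<close> and \<open>t\<close>, so all factors are polynomials in
  \<open>i\<close>. The contributions of \<open>m\<close> to the degree cancel, leaving at most
  \<open>s + t = n - 1\<close>.\<close>

lemma functional_hyp3F2_poly_eq_0:
  assumes "m < n"
  shows "moment_functional (weight_moments a b c d m)
     (hyp3F2_poly a b (c + real (n div 2)) (d + real ((n - 1) div 2)) n) = 0"
proof -
  define s t where "s = n div 2" and "t = (n - 1) div 2"
  define p where "p = pochhammer [:a, 1:] (m div 2) * pochhammer [:b, 1:] ((m + 1) div 2) *
     pochhammer [:c + real ((m + 1) div 2), 1:] (s - (m + 1) div 2) *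
     pochhammer [:d + real (m div 2), 1:] (t - m div 2)"
  have le: "(m + 1) div 2 \<le> s" "m div 2 \<le> t" using assms by (auto simp: s_def t_def)
  have "degree p \<le> m div 2 + (m + 1) div 2 + (s - (m + 1) div 2) + (t - m div 2)"
    unfolding p_def by (intro order_trans[OF degree_mult_le] add_mono degree_pochhammer_linear_le)
  also have "\<dots> < n" using assms le by (simp add: s_def t_def)
  finally have "(\<Sum>i\<le>n. (-1) ^ i * of_nat (n choose i) * poly p (of_nat i)) = 0"
    by (rule alternating_binomial_sum_poly_eq_0)
  moreover have "pochhammer (a + real i) (m div 2) * pochhammer (b + real i) ((m + 1) div 2) *
       (pochhammer (c + real s) i / pochhammer c (i + (m + 1) div 2)) *
       (pochhammer (d + real t) i / pochhammer d (i + m div 2)) =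
     poly p (of_nat i) / (pochhammer c s * pochhammer d t)" for i
    unfolding pochhammer_shift_quotient(1)[OF pos(3) le(1)] pochhammer_shift_quotient(1)[OF pos(4) le(2)]
    by (simp add: p_def poly_pochhammer add_ac)
  ultimately show ?thesis unfolding functional_hyp3F2_poly s_def[symmetric] t_def[symmetric]
    by (simp add: sum_divide_distrib[symmetric])
qed

lemma pos_pochhammer: "pochhammer a k > 0" "pochhammer b k > 0" "pochhammer c k > 0" "pochhammer d k > 0"
  using pos by (auto intro: pochhammer_pos)

text \<open>At \<open>m = n = 2 * k\<close> the shift of \<open>d\<close> exceeds
  \<open>t = k - 1\<close> by one, giving a pole at \<open>i = -z\<close>; the quotient for
  \<open>c\<close> is constant in \<open>i\<close>, and the numerator has degree at most
  \<open>n\<close>.\<close>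

lemma functional_hyp3F2_poly_even:
  assumes "k > 0"
  shows "moment_functional (weight_moments a b c d (2 * k))
     (hyp3F2_poly a b (c + real k) (d + real (k - 1)) (2 * k)) =
     pochhammer a (2 * k) * pochhammer b (2 * k) * pochhammer (d - a) k * pochhammer (d - b) k * fact (2 * k) *
     pochhammer d (k - 1) / (pochhammer c (3 * k) * pochhammer d (3 * k - 1) * pochhammer d (3 * k))"
proof -
  define z where "z = d + real (k - 1)"
  have z: "z > 0" using pos by (simp add: z_def)
  define p where "p = pochhammer [:a, 1:] k * pochhammer [:b, 1:] k"
  have "degree p \<le> k + k"
    unfolding p_def by (intro order_trans[OF degree_mult_le] add_mono degree_pochhammer_linear_le)
  hence deg: "degree p \<le> 2 * k" by simp
  have "pochhammer (a + real i) (2 * k div 2) * pochhammer (b + real i) ((2 * k + 1) div 2) *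
       (pochhammer (c + real k) i / pochhammer c (i + (2 * k + 1) div 2)) *
       (pochhammer (d + real (k - 1)) i / pochhammer d (i + 2 * k div 2)) =
     (poly p (of_nat i) / (z + of_nat i)) / (pochhammer c k * pochhammer d (k - 1))" for i
    using pochhammer_shift_quotient(1)[OF pos(3) order_refl, of k i]
      pochhammer_shift_quotient(2)[OF pos(4), of "k - 1" i] assms
    by (simp add: p_def poly_pochhammer add_ac z_def)
  hence "moment_functional (weight_moments a b c d (2 * k))
     (hyp3F2_poly a b (c + real k) (d + real (k - 1)) (2 * k)) =
     pochhammer a (2 * k) * pochhammer b (2 * k) / (pochhammer (c + real k) (2 * k) * pochhammer z (2 * k)) *
       ((\<Sum>i\<le>2 * k. (-1) ^ i * of_nat (2 * k choose i) * (poly p (of_nat i) / (z + of_nat i))) /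
        (pochhammer c k * pochhammer d (k - 1)))"
    unfolding functional_hyp3F2_poly by (simp add: sum_divide_distrib z_def)
  also have "(\<Sum>i\<le>2 * k. (-1) ^ i * of_nat (2 * k choose i) * (poly p (of_nat i) / (z + of_nat i))) =
     poly p (-z) * fact (2 * k) / pochhammer z (Suc (2 * k))"
    by (rule alternating_binomial_sum_poly_div[OF z deg])
  also have "poly p (-z) = pochhammer (d - a) k * pochhammer (d - b) k"
  proof -
    have eq: "a - z = - (d - a) - real k + 1" "b - z = - (d - b) - real k + 1"
      using assms by (auto simp: z_def of_nat_diff)
    have "poly p (-z) = pochhammer (a - z) k * pochhammer (b - z) k"
      by (simp add: p_def poly_pochhammer)
    also have "\<dots> = ((-1) ^ k * (-1) ^ k) * (pochhammer (d - a) k * pochhammer (d - b) k)"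
      unfolding eq pochhammer_reflect by (simp only: mult_ac)
    finally show ?thesis by (simp flip: power_mult_distrib)
  qed
  finally have 1: "moment_functional (weight_moments a b c d (2 * k))
     (hyp3F2_poly a b (c + real k) (d + real (k - 1)) (2 * k)) =
     pochhammer a (2 * k) * pochhammer b (2 * k) / (pochhammer (c + real k) (2 * k) * pochhammer z (2 * k)) *
     (pochhammer (d - a) k * pochhammer (d - b) k * fact (2 * k) / pochhammer z (Suc (2 * k)) /
        (pochhammer c k * pochhammer d (k - 1)))" .
  \<comment> \<open>Merging into long symbols makes the values for \<open>k\<close> and
    \<open>k + 1\<close> differ by three factors in each of them.\<close>
  have 2: "pochhammer c (3 * k) = pochhammer c k * pochhammer (c + real k) (2 * k)"
    using pochhammer_product'[of c k "2 * k"] by (simp add: mult_ac)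
  have 3: "pochhammer d (3 * k - 1) = pochhammer d (k - 1) * pochhammer z (2 * k)"
    "pochhammer d (3 * k) = pochhammer d (k - 1) * pochhammer z (Suc (2 * k))"
    using pochhammer_product'[of d "k - 1" "2 * k"] pochhammer_product'[of d "k - 1" "Suc (2 * k)"] assms
    by (simp_all add: z_def mult_ac)
  show ?thesis unfolding 1 2 3 using pos_pochhammer(4)[of "k - 1"] by simp (simp only: mult_ac)
qed

text \<open>Now \<open>s = t = k\<close>, and it is the shift \<open>k + 1\<close> of
  \<open>c\<close> that exceeds \<open>s\<close> by one, so the pole comes from \<open>c\<close>.
  The sign from reflection cancels \<open>(-1) ^ n\<close>.\<close>

lemma functional_hyp3F2_poly_odd:
  "moment_functional (weight_moments a b c d (2 * k + 1))
     (hyp3F2_poly a b (c + real k) (d + real k) (2 * k + 1)) =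
     c / b * pochhammer a (2 * k + 1) * pochhammer b (2 * k + 1) * pochhammer (c - a + 1) k *
     pochhammer (c - b) (k + 1) * fact (2 * k + 1) * pochhammer c k /
     (pochhammer c (3 * k + 1) * pochhammer c (3 * k + 2) * pochhammer d (3 * k + 1))"
proof -
  define z where "z = c + real k"
  have z: "z > 0" using pos by (simp add: z_def)
  define n where "n = 2 * k + 1"
  define p where "p = pochhammer [:a, 1:] k * pochhammer [:b, 1:] (k + 1)"
  have "degree p \<le> k + (k + 1)"
    unfolding p_def by (intro order_trans[OF degree_mult_le] add_mono degree_pochhammer_linear_le)
  hence deg: "degree p \<le> n" by (simp add: n_def)
  have n: "n mod 2 = 1" "n div 2 = k" "(n + 1) div 2 = Suc k" "(-1::real) ^ n = -1" by (simp_all add: n_def)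
  have "pochhammer (a + real i) k * pochhammer (b + real i) (Suc k) *
       (pochhammer (c + real k) i / pochhammer c (i + Suc k)) *
       (pochhammer (d + real k) i / pochhammer d (i + k)) =
     (poly p (of_nat i) / (z + of_nat i)) / (pochhammer c k * pochhammer d k)" for i
    unfolding pochhammer_shift_quotient(1)[OF pos(4) order_refl] pochhammer_shift_quotient(2)[OF pos(3)]
    by (simp add: p_def poly_pochhammer add_ac z_def)
  hence "moment_functional (weight_moments a b c d n)
     (hyp3F2_poly a b (c + real k) (d + real k) n) =
     c / b * (- pochhammer a n * pochhammer b n / (pochhammer z n * pochhammer (d + real k) n)) *
       ((\<Sum>i\<le>n. (-1) ^ i * of_nat (n choose i) * (poly p (of_nat i) / (z + of_nat i))) /
        (pochhammer c k * pochhammer d k))"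
    unfolding functional_hyp3F2_poly n by (simp add: sum_divide_distrib z_def)
  also have "(\<Sum>i\<le>n. (-1) ^ i * of_nat (n choose i) * (poly p (of_nat i) / (z + of_nat i))) =
     poly p (-z) * fact n / pochhammer z (Suc n)"
    by (rule alternating_binomial_sum_poly_div[OF z deg])
  also have "poly p (-z) = - (pochhammer (c - a + 1) k * pochhammer (c - b) (k + 1))"
  proof -
    have eq: "a - z = - (c - a + 1) - real k + 1" "b - z = - (c - b) - real (k + 1) + 1"
      by (auto simp: z_def)
    have "poly p (-z) = pochhammer (a - z) k * pochhammer (b - z) (k + 1)"
      by (simp add: p_def poly_pochhammer)
    also have "\<dots> = ((-1) ^ k * (-1) ^ (k + 1)) * (pochhammer (c - a + 1) k * pochhammer (c - b) (k + 1))"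
      unfolding eq pochhammer_reflect by (simp only: mult_ac)
    finally show ?thesis by (simp flip: power_mult_distrib)
  qed
  finally have 1: "moment_functional (weight_moments a b c d n)
     (hyp3F2_poly a b (c + real k) (d + real k) n) =
     c / b * (pochhammer a n * pochhammer b n / (pochhammer z n * pochhammer (d + real k) n)) *
     (pochhammer (c - a + 1) k * pochhammer (c - b) (k + 1) * fact n / pochhammer z (Suc n) /
        (pochhammer c k * pochhammer d k))"
    by simp
  have 2: "pochhammer d (3 * k + 1) = pochhammer d k * pochhammer (d + real k) n"
    using pochhammer_product'[of d k n] by (simp add: n_def mult_ac)
  have 3: "pochhammer c (3 * k + 1) = pochhammer c k * pochhammer z n"
    "pochhammer c (3 * k + 2) = pochhammer c k * pochhammer z (Suc n)"
    using pochhammer_product'[of c k n] pochhammer_product'[of c k "Suc n"]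
    by (simp_all add: z_def n_def)
  show ?thesis unfolding n_def[symmetric] 1 2 3 using pos_pochhammer(3)[of k] by simp (simp only: mult_ac)
qed

end

section \<open>Two-orthogonality and the recurrence\<close>

text \<open>Both components are instances of \<open>weight_moment\<close>; for the second,
  \<open>b\<close> and \<open>c\<close> grow together, so the required \<open>b < c\<close> is
  preserved.\<close>

lemma integral_poly_weight_vec:
  fixes a b c d :: real
  assumes pos: "a > 0" "b > 0" "c > 0" "d > 0" and less: "min c d > max a b" and j: "j \<in> {0, 1}"
  shows "(LBINT x:{0<..<1}. x ^ k * poly p x * weight_vec a b c d j x) =
    moment_functional (weight_moments a b c d (2 * k + j)) p"
proof -
  have int: "set_integrable lborel {0<..<1} (\<lambda>x. x ^ m * weight_vec a b c d j x)"
    and eq: "(LBINT x:{0<..<1}. x ^ (i + k) * weight_vec a b c d j x) = weight_moments a b c d (2 * k + j) i" for m i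
  proof -
    have "b + 1 < c + 1" "a + (b + 1) < (c + 1) + d" "b + 1 > 0" "c + 1 > 0" "b < c" "a + b < c + d"
      using pos less by auto
    thus "set_integrable lborel {0<..<1} (\<lambda>x. x ^ m * weight_vec a b c d j x)"
      using pos by (auto simp: weight_vec_def intro: weight_moment)
    show "(LBINT x:{0<..<1}. x ^ (i + k) * weight_vec a b c d j x) = weight_moments a b c d (2 * k + j) i"
    proof (cases "j = 0")
      case True
      thus ?thesis using weight_moment(2)[OF pos \<open>b < c\<close> \<open>a + b < c + d\<close>, of "i + k"]
        by (simp add: weight_vec_def weight_moments_def)
    next
      case False
      hence [simp]: "j = 1" using j by simp
      show ?thesis
        using weight_moment(2)[OF pos(1) \<open>b + 1 > 0\<close> \<open>c + 1 > 0\<close> pos(4) \<open>b + 1 < c + 1\<close> \<open>a + (b + 1) < (c + 1) + d\<close>, of "i + k"] pos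
        by (simp add: weight_vec_def weight_moments_def pochhammer_rec)
    qed
  qed
  have "(LBINT x:{0<..<1}. x ^ k * poly p x * weight_vec a b c d j x) =
    (LBINT x:{0<..<1}. \<Sum>i\<le>degree p. coeff p i * (x ^ (i + k) * weight_vec a b c d j x))"
    by (intro set_lebesgue_integral_cong) (auto simp: poly_altdef sum_distrib_left sum_distrib_right power_add mult_ac)
  also have "\<dots> = (\<Sum>i\<le>degree p. LBINT x:{0<..<1}. coeff p i * (x ^ (i + k) * weight_vec a b c d j x))"
  proof -
    have "integrable lborel (\<lambda>x. indicator {0<..<1} x *\<^sub>R (coeff p i * (x ^ (i + k) * weight_vec a b c d j x)))" for i
      using set_integrable_mult_right[of "coeff p i", OF int[of "i + k"]] by (simp add: set_integrable_def)
    thus ?thesis unfolding set_lebesgue_integral_def scaleR_sum_right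
      by (rule Bochner_Integration.integral_sum)
  qed
  also have "\<dots> = moment_functional (weight_moments a b c d (2 * k + j)) p"
    by (simp add: eq moment_functional_def)
  finally show ?thesis .
qed

text \<open>With \<open>moment_functional_pCons_0\<close>: multiplying the polynomial by x raises
  the functional's index by two, which is why the recurrence reaches back to
  \<open>n - 2\<close>.\<close>

lemma weight_moments_Suc: "weight_moments a b c d m (Suc i) = weight_moments a b c d (m + 2) i"
  by (simp add: weight_moments_def)

text \<open>This is the paper's \<open>c'\<close> with index \<open>n - 1\<close>.\<close>

definition shifted_param :: "real \<Rightarrow> real \<Rightarrow> nat \<Rightarrow> real" where
  "shifted_param c d n = (if even n then c else d) + real (n div 2)"

text \<open>The truncated subtraction is harmless: for \<open>n = 0\<close> the parameters do not enter.\<close>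

definition two_orthogonal_poly :: "real \<Rightarrow> real \<Rightarrow> real \<Rightarrow> real \<Rightarrow> nat \<Rightarrow> real poly" where
  "two_orthogonal_poly a b c d n = hyp3F2_poly a b (c + real (n div 2)) (d + real ((n - 1) div 2)) n"

text \<open>The parity of \<open>n\<close> only decides which parameter comes first, and the 3F2 is
  symmetric in them; this makes the coefficient formulas uniform.\<close>

lemma two_orthogonal_poly_Suc:
  "two_orthogonal_poly a b c d (Suc n) = hyp3F2_poly a b (shifted_param c d n) (shifted_param c d (Suc n)) (Suc n)"
  by (cases "even n") (auto simp: two_orthogonal_poly_def shifted_param_def hyp3F2_poly_commute[of a b "c + _" "d + _"] elim!: evenE oddE)

lemma degree_two_orthogonal_poly [simp]: "degree (two_orthogonal_poly a b c d n) = n"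
  and lead_coeff_two_orthogonal_poly [simp]: "coeff (two_orthogonal_poly a b c d n) n = 1"
  by (simp_all add: two_orthogonal_poly_def)

section \<open>Ratios of diagonal values\<close>

context
  fixes a b c d :: real
  assumes pos: "a > 0" "b > 0" "c > 0" "d > 0"
begin

private abbreviation "L \<equiv> \<lambda>m. moment_functional (weight_moments a b c d m)"
private abbreviation "Q \<equiv> two_orthogonal_poly a b c d"
private abbreviation "e \<equiv> shifted_param c d"

lemma functional_two_orthogonal_poly_eq_0: "m < n \<Longrightarrow> L m (Q n) = 0"
  using functional_hyp3F2_poly_eq_0[OF pos] by (simp add: two_orthogonal_poly_def)

text \<open>Index 0 has the factor \<open>d - 1\<close> cancelled: for \<open>d = 1\<close> the
  uncancelled quotient would be 0/0, which evaluates to 0.\<close>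

lemma functional_two_orthogonal_poly_step_0:
  "L 2 (Q 2) = pochhammer 1 2 * pochhammer a 2 * pochhammer b 2 * (d - a) * (d - b)
            / (pochhammer c 3 * pochhammer d 3 * (d * (d + 1))) * L 0 (Q 0)"
proof -
  have "L 0 (Q 0) = 1"
    by (simp add: moment_functional_def weight_moments_def)
  thus ?thesis using functional_hyp3F2_poly_even[OF pos, of 1] pos
    by (simp add: two_orthogonal_poly_def pochhammer_Suc numeral_2_eq_2 fact_numeral) (simp add: algebra_simps)
qed

text \<open>The ratio is the formula for \<gamma> at \<open>m + 1\<close>: consecutive evaluations
  of the same parity are divided, and \<open>e (Suc m)\<close> belongs to the parameter carrying the
  pole.\<close>

lemma functional_two_orthogonal_poly_step:
  assumes "m > 0"
  shows "L (m + 2) (Q (m + 2)) =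
     pochhammer (real m + 1) 2 * pochhammer (a + real m) 2 * pochhammer (b + real m) 2
       * (e (Suc m) - 1) * (e (Suc m) - a) * (e (Suc m) - b)
       / (pochhammer (e m + real m) 3 * pochhammer (e (Suc m) + real m) 3 * pochhammer (e (Suc m) + real m - 1) 3)
     * L m (Q m)"
proof -
  have split: "pochhammer z (m + 2) = pochhammer z m * pochhammer (z + real m) 2" for z :: real
    by (rule pochhammer_product')
  have fact: "fact (m + 2) = (fact m :: real) * pochhammer (real m + 1) 2"
    using split[of 1] by (simp only: pochhammer_fact add.commute)
  show ?thesis
  proof (cases "even m")
    case True
    then obtain k where m: "m = 2 * k" by (elim evenE)
    have k: "k > 0" using assms m by simp
    have e: "e m = c + real k" "e (Suc m) = d + real k" by (simp_all add: m shifted_param_def)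
    \<comment> \<open>The term \<open>k + 1 - 1\<close> stays unsimplified to match the even
      evaluation at \<open>k + 1\<close>.\<close>
    have Q: "Q m = hyp3F2_poly a b (c + real k) (d + real (k - 1)) (2 * k)"
      "Q (m + 2) = hyp3F2_poly a b (c + real (k + 1)) (d + real (k + 1 - 1)) (2 * (k + 1))"
    proof -
      have "2 * k div 2 = k" "(2 * k - 1) div 2 = k - 1" "2 * k + 2 = 2 * (k + 1)"
        "2 * (k + 1) div 2 = k + 1" "(2 * (k + 1) - 1) div 2 = k + 1 - 1" using k by auto
      thus "Q m = hyp3F2_poly a b (c + real k) (d + real (k - 1)) (2 * k)"
        "Q (m + 2) = hyp3F2_poly a b (c + real (k + 1)) (d + real (k + 1 - 1)) (2 * (k + 1))"
        unfolding two_orthogonal_poly_def m by presburger+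
    qed
    have I1: "L m (Q m) = pochhammer a m * pochhammer b m * pochhammer (d - a) k * pochhammer (d - b) k * fact m *
     pochhammer d (k - 1) / (pochhammer c (3 * k) * pochhammer d (3 * k - 1) * pochhammer d (3 * k))"
      unfolding Q unfolding m by (rule functional_hyp3F2_poly_even[OF pos k])
    have "L (2 * (k + 1)) (Q (m + 2)) = pochhammer a (2 * (k + 1)) * pochhammer b (2 * (k + 1)) *
       pochhammer (d - a) (k + 1) * pochhammer (d - b) (k + 1) * fact (2 * (k + 1)) *
       pochhammer d (k + 1 - 1) / (pochhammer c (3 * (k + 1)) * pochhammer d (3 * (k + 1) - 1) * pochhammer d (3 * (k + 1)))"
      unfolding Q by (rule functional_hyp3F2_poly_even[OF pos]) simp
    also have "2 * (k + 1) = m + 2" by (simp add: m)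
    also have "k + 1 - 1 = Suc (k - 1)" using k by simp
    also have "3 * (k + 1) - 1 = (3 * k - 1) + 3" using k by simp
    also have "3 * (k + 1) = 3 * k + 3" by simp
    finally have I2: "L (m + 2) (Q (m + 2)) = pochhammer a (m + 2) * pochhammer b (m + 2) *
       pochhammer (d - a) (k + 1) * pochhammer (d - b) (k + 1) * fact (m + 2) *
       pochhammer d (Suc (k - 1)) / (pochhammer c (3 * k + 3) * pochhammer d ((3 * k - 1) + 3) * pochhammer d (3 * k + 3))" .
    have eqs: "c + real k + real m = c + real (3 * k)" "d + real k + real m = d + real (3 * k)"
      "d + real (3 * k) - 1 = d + real (3 * k - 1)" "d + real k - 1 = d + real (k - 1)"
      "d + real k - a = d - a + real k" "d + real k - b = d - b + real k"
      using k by (simp_all add: m of_nat_diff)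
    show ?thesis
      unfolding I1 I2 split fact e eqs pochhammer_product'[of _ _ 3] pochhammer_Suc[of d] Suc_eq_plus1[symmetric]
        pochhammer_Suc[of "d - a"] pochhammer_Suc[of "d - b"]
      by (simp add: mult_ac)
  next
    case False
    then obtain k where m: "m = 2 * k + 1" by (elim oddE)
    have e: "e m = d + real k" "e (Suc m) = c + real (k + 1)" by (simp_all add: m shifted_param_def)
    have Q: "Q m = hyp3F2_poly a b (c + real k) (d + real k) (2 * k + 1)"
      "Q (m + 2) = hyp3F2_poly a b (c + real (k + 1)) (d + real (k + 1)) (2 * (k + 1) + 1)"
      by (simp_all add: two_orthogonal_poly_def m)
    have I1: "L m (Q m) = c / b * pochhammer a m * pochhammer b m * pochhammer (c - a + 1) k *
     pochhammer (c - b) (k + 1) * fact m * pochhammer c k /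
     (pochhammer c (3 * k + 1) * pochhammer c (3 * k + 2) * pochhammer d (3 * k + 1))"
      unfolding Q unfolding m by (rule functional_hyp3F2_poly_odd[OF pos])
    have "L (2 * (k + 1) + 1) (Q (m + 2)) = c / b * pochhammer a (2 * (k + 1) + 1) * pochhammer b (2 * (k + 1) + 1) *
     pochhammer (c - a + 1) (k + 1) *
     pochhammer (c - b) (k + 1 + 1) * fact (2 * (k + 1) + 1) * pochhammer c (k + 1) /
     (pochhammer c (3 * (k + 1) + 1) * pochhammer c (3 * (k + 1) + 2) * pochhammer d (3 * (k + 1) + 1))"
      unfolding Q by (rule functional_hyp3F2_poly_odd[OF pos])
    also have "2 * (k + 1) + 1 = m + 2" by (simp add: m)
    also have "3 * (k + 1) + 1 = (3 * k + 1) + 3" by simp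
    also have "3 * (k + 1) + 2 = (3 * k + 2) + 3" by simp
    finally have I2: "L (m + 2) (Q (m + 2)) = c / b * pochhammer a (m + 2) * pochhammer b (m + 2) *
     pochhammer (c - a + 1) (k + 1) *
     pochhammer (c - b) (k + 1 + 1) * fact (m + 2) * pochhammer c (k + 1) /
     (pochhammer c ((3 * k + 1) + 3) * pochhammer c ((3 * k + 2) + 3) * pochhammer d ((3 * k + 1) + 3))" .
    have eqs: "d + real k + real m = d + real (3 * k + 1)" "c + real (k + 1) + real m = c + real (3 * k + 2)"
      "c + real (3 * k + 2) - 1 = c + real (3 * k + 1)" "c + real (k + 1) - 1 = c + real k"
      "c + real (k + 1) - a = c - a + 1 + real k" "c + real (k + 1) - b = c - b + real (k + 1)"
      by (simp_all add: m)
    show ?thesis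
      unfolding I1 I2 split fact e eqs pochhammer_product'[of _ _ 3] pochhammer_product'[of _ _ 1] pochhammer_1
      by (simp add: mult_ac)
  qed
qed

end

text \<open>The comparison of coefficients at \<open>l\<close> that confirms \<alpha>. The squares
  of \<open>N1\<close> cancel, and the \<open>N0\<close> terms agree without clearing denominators,
  so \<open>x - 1\<close> and \<open>y - 1\<close> may vanish.\<close>

lemma third_coeff_identity:
  fixes N0 N1 N2 x y :: real
  assumes "x > 0" "y > 0"
  shows "N2 * N1 / (2 * (y * (y + 1) * (x + 1) * (x + 2))) =
     N1 * N0 / (2 * ((x - 1) * x * (y - 1) * y)) + (N2 / ((y + 1) * (x + 2)) - N1 / (x * y)) * (N1 / (x * y))
     - N1 / (x * y) * (N0 / (2 * (x - 1) * (y - 1)) - N1 / (x * y) + N2 / (2 * (x + 1) * (y + 1)))"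
proof -
  have "N2 * N1 / (2 * (y * (y + 1) * (x + 1) * (x + 2))) =
      N2 / ((y + 1) * (x + 2)) * (N1 / (x * y)) - N1 / (x * y) * (N2 / (2 * (x + 1) * (y + 1)))"
    using assms by (simp add: divide_simps) (simp add: algebra_simps)
  moreover have "N1 * N0 / (2 * ((x - 1) * x * (y - 1) * y)) = N1 / (x * y) * (N0 / (2 * (x - 1) * (y - 1)))"
    by (simp add: algebra_simps)
  ultimately show ?thesis by (simp add: algebra_simps)
qed

theorem theorem3p4:
  fixes a b c d :: real
    and P :: "int \<Rightarrow> real poly"
    and c' \<beta> \<alpha> \<gamma> :: "int \<Rightarrow> real"
  assumes pos: "a > 0" "b > 0" "c > 0" "d > 0"
    and less: "min c d > max a b"
    and orth: "monic_2_orthogonal (weight_vec a b c d) (\<lambda>n. P (int n))"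
    and P_neg: "P (-2) = 0" "P (-1) = 0"
    and c'_odd: "\<And>k::nat. c' (2 * int k - 1) = c + real k"
    and c'_even: "\<And>k::nat. c' (2 * int k) = d + real k"
    and \<beta>: "\<And>n::nat. \<beta> (int n) =
          (real n + 1) * (a + real n) * (b + real n)
            / ((c' (int n - 1) + real n) * (c' (int n) + real n))
        - real n * (a + real n - 1) * (b + real n - 1)
            / ((c' (int n - 1) + real n - 1) * (c' (int n) + real n - 2))"
    and \<alpha>: "\<And>n::nat. \<alpha> (int n + 1) =
          (real n + 1) * (a + real n) * (b + real n)
            / ((c' (int n - 1) + real n) * (c' (int n) + real n))
        * (real n * (a + real n - 1) * (b + real n - 1)
             / (2 * (c' (int n - 1) + real n - 1) * (c' (int n) + real n - 1))
           - (real n + 1) * (a + real n) * (b + real n)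
             / ((c' (int n - 1) + real n) * (c' (int n) + real n))
           + (real n + 2) * (a + real n + 1) * (b + real n + 1)
             / (2 * (c' (int n - 1) + real n + 1) * (c' (int n) + real n + 1)))"
    and \<gamma>_one: "\<gamma> 1 =
          pochhammer 1 2 * pochhammer a 2 * pochhammer b 2 * (c' 0 - a) * (c' 0 - b)
            / (pochhammer (c' (-1)) 3 * pochhammer (c' 0) 3 * (d * (d + 1)))"
    and \<gamma>: "\<And>n::nat. n \<ge> 1 \<Longrightarrow> \<gamma> (int n + 1) =
          pochhammer (real n + 1) 2 * pochhammer (a + real n) 2 * pochhammer (b + real n) 2
            * (c' (int n) - 1) * (c' (int n) - a) * (c' (int n) - b)
            / (pochhammer (c' (int n - 1) + real n) 3 * pochhammer (c' (int n) + real n) 3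
               * pochhammer (c' (int n) + real n - 1) 3)"
  shows "P 0 = 1 \<and>
         (\<forall>n::nat. P (int n + 1) =
            [:- \<beta> (int n), 1:] * P (int n)
            - smult (\<alpha> (int n)) (P (int n - 1))
            - smult (\<gamma> (int n - 1)) (P (int n - 2)))"

proof -
  define p where "p = (\<lambda>n. P (int n))"
  let ?L = "\<lambda>m. moment_functional (weight_moments a b c d m)"
  let ?Q = "two_orthogonal_poly a b c d"
  define e where "e = shifted_param c d"
  have e_pos: "e n > 0" for n using pos by (simp add: e_def shifted_param_def add_pos_nonneg)
  have e_rec: "e (Suc (Suc n)) = e n + 1" for n by (simp add: e_def shifted_param_def)
  have c'_pred: "c' (int n - 1) = e n" for n
    using c'_odd[of "n div 2"] c'_even[of "n div 2"]
    by (cases "even n") (auto simp: e_def shifted_param_def elim!: evenE oddE)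
  have c'_e: "c' (int n) = e (Suc n)" for n
    using c'_pred[of "Suc n"] by simp
  have p: "degree (p n) = n" "lead_coeff (p n) = 1" for n
    using orth unfolding monic_2_orthogonal_def p_def by blast+
  \<comment> \<open>Writing \<open>m = 2 * k + j\<close> merges the two families of orthogonality
    relations into one triangular family.\<close>
  have L_integral: "?L m q = (LBINT x:{0<..<1}. x ^ (m div 2) * poly q x * weight_vec a b c d (m mod 2) x)" for m q
  proof -
    have "m mod 2 \<in> {0, 1}" by auto
    from integral_poly_weight_vec[OF pos less this, of "m div 2" q] show ?thesis by simp
  qed
  note o = conjunct2[OF orth[unfolded monic_2_orthogonal_def]]
  have orth_0: "(LBINT x:{0<..<1}. x ^ k * poly (p n) x * weight_vec a b c d j x) = 0"
    if "j \<in> {0, 1}" "n \<ge> 2 * k + j + 1" for j k n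
    unfolding p_def by (rule conjunct1[OF spec[OF spec[OF bspec[OF o that(1)]]], THEN mp, OF that(2)])
  have orth_nz: "(LBINT x:{0<..<1}. x ^ k * poly (p n) x * weight_vec a b c d j x) \<noteq> 0"
    if "j \<in> {0, 1}" "n = 2 * k + j" for j k n
    unfolding p_def by (rule conjunct2[OF spec[OF spec[OF bspec[OF o that(1)]]], THEN mp, OF that(2)])
  have L_p: "?L m (p n) = 0" if "m < n" for m n
    unfolding L_integral using that by (intro orth_0) auto
  have L_p_nz: "?L n (p n) \<noteq> 0" for n
    unfolding L_integral by (intro orth_nz) auto
  note zeroI = triangular_functionals_imp_zero[OF p L_p L_p_nz]
  \<comment> \<open>Both are monic of degree \<open>n\<close>, so the difference has only
    coefficients below \<open>n\<close> and is annihilated by the first \<open>n\<close>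
    functionals.\<close>
  have p_Q: "p n = ?Q n" for n
  proof -
    have "?Q n - p n = 0"
    proof (rule zeroI)
      fix i assume "i \<ge> n"
      thus "coeff (?Q n - p n) i = 0"
        using p[of n] by (cases "i = n") (simp_all add: coeff_eq_0)
    next
      fix m assume "m < n"
      thus "?L m (?Q n - p n) = 0"
        by (simp add: moment_functional_diff L_p functional_two_orthogonal_poly_eq_0[OF pos])
    qed
    thus ?thesis by simp
  qed
  have second: "coeff (p (Suc l)) l = - ((real l + 1) * (a + real l) * (b + real l) / ((e l + real l) * (e (Suc l) + real l)))" for l
    unfolding p_Q two_orthogonal_poly_Suc coeff_hyp3F2_poly_second e_def ..
  have third: "coeff (p (Suc (Suc l))) l =
     ((real l + 2) * (a + real l + 1) * (b + real l + 1)) * ((real l + 1) * (a + real l) * (b + real l)) /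
     (2 * ((e (Suc l) + real l) * (e (Suc l) + real l + 1) * (e l + 1 + real l) * (e l + 1 + real l + 1)))" for l
    unfolding p_Q two_orthogonal_poly_Suc coeff_hyp3F2_poly_third e_def[symmetric] e_rec ..
  have P0: "P 0 = 1"
  proof -
    obtain r where "p 0 = [:r:]" using p(1)[of 0] by (rule degree_eq_zeroE)
    thus ?thesis using p(2)[of 0] by (simp add: p_def one_pCons)
  qed
  have step: "P (int n + 1) = [:- \<beta> (int n), 1:] * P (int n) - smult (\<alpha> (int n)) (P (int n - 1))
            - smult (\<gamma> (int n - 1)) (P (int n - 2))" for n
  proof (cases n)
    case 0
    have "p 1 = [:- \<beta> 0, 1:]"
    proof (rule poly_eqI)
      fix i :: nat
      consider "i = 0" | "i = 1" | "i > 1" by linarith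
      thus "coeff (p 1) i = coeff [:- \<beta> 0, 1:] i"
        using second[of 0] p[of 1] \<beta>[of 0] c'_pred[of 0] c'_e[of 0]
        by cases (auto simp: coeff_eq_0 coeff_pCons split: nat.splits)
    qed
    thus ?thesis using 0 P_neg P0 by (simp add: p_def)
  next
    case (Suc l)
    \<comment> \<open>For \<open>n = Suc l\<close> this is the last term of the recurrence; of
      degree below \<open>l\<close> or zero, it does not enter the three leading
      coefficients.\<close>
    define g where "g = smult (\<gamma> (int l)) (P (int l - 1))"
    have g_coeff: "coeff g i = 0" if "i \<ge> l" for i
    proof (cases l)
      case 0
      thus ?thesis using P_neg by (simp add: g_def)
    next
      case (Suc q)
      thus ?thesis using that p(1)[of q] by (simp add: g_def p_def coeff_eq_0)
    qed
    define B where "B = \<beta> (int (Suc l))"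
    define A where "A = \<alpha> (int (Suc l))"
    define R where "R = p (Suc (Suc l)) - ([:- B, 1:] * p (Suc l) - smult A (p l) - g)"
    have R: "R = p (Suc (Suc l)) - pCons 0 (p (Suc l)) + smult B (p (Suc l)) + smult A (p l) + g"
      by (simp add: R_def)
    \<comment> \<open>The coefficients of \<open>R\<close> from \<open>l\<close> on vanish by the
      choice of \<open>B\<close> and \<open>A\<close>; \<gamma> makes the functionals below
      \<open>l\<close> vanish.\<close>
    have "R = 0"
    proof (rule zeroI)
      fix i assume i: "i \<ge> l"
      consider "i = l" | "i = Suc l" | "i = Suc (Suc l)" | "i > Suc (Suc l)" using i by linarith
      thus "coeff R i = 0"
      proof cases
        case 1
        define N where "N = (\<lambda>t::real. t * (a + t - 1) * (b + t - 1))"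
        define x y where "x = e l + real l" and "y = e (Suc l) + real l"
        have xy: "x > 0" "y > 0" using e_pos by (auto simp: x_def y_def add_pos_nonneg)
        \<comment> \<open>For \<open>l = 0\<close> there is no coefficient to carry up, in
          accordance with \<open>N 0 = 0\<close>.\<close>
        have "coeff (pCons 0 (p (Suc l))) l = N (real l + 1) * N (real l) / (2 * ((x - 1) * x * (y - 1) * y))"
        proof (cases l)
          case 0
          thus ?thesis by (simp add: N_def)
        next
          case (Suc q)
          have "x - 1 = e (Suc q) + real q" "x = e (Suc q) + real q + 1"
            "y - 1 = e q + 1 + real q" "y = e q + 1 + real q + 1"
            by (simp_all add: x_def y_def Suc e_rec)
          thus ?thesis unfolding Suc coeff_pCons_Suc third N_def by (simp add: add_ac)
        qed
        moreover have "coeff (p (Suc l)) l = - (N (real l + 1) / (x * y))"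
          unfolding second x_def y_def N_def by simp
        moreover have "coeff (p (Suc (Suc l))) l = N (real l + 2) * N (real l + 1) / (2 * (y * (y + 1) * (x + 1) * (x + 2)))"
          unfolding third x_def y_def N_def by (simp add: add_ac)
        \<comment> \<open>At index \<open>Suc l\<close>, \<open>e_rec\<close> turns the last
          parameter into \<open>e l + 1\<close>; this accounts for \<open>x + 2\<close>, and for the
          \<open>- 2\<close> in \<beta>, which leaves \<open>x\<close>.\<close>
        moreover have "B = N (real l + 2) / ((y + 1) * (x + 2)) - N (real l + 1) / (x * y)"
          unfolding B_def \<beta> c'_pred c'_e e_rec N_def x_def y_def by (simp add: add_ac mult_ac)
        moreover have "A = N (real l + 1) / (x * y) * (N (real l) / (2 * (x - 1) * (y - 1))
             - N (real l + 1) / (x * y) + N (real l + 2) / (2 * (x + 1) * (y + 1)))"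
          using \<alpha>[of l] unfolding A_def c'_pred c'_e N_def x_def y_def by (simp add: add_ac)
        moreover have "coeff (p l) l = 1" using p[of l] by simp
        ultimately show ?thesis
          using g_coeff[OF i] third_coeff_identity[OF xy, of "N (real l + 2)" "N (real l + 1)" "N (real l)"] 1
          by (simp add: R del: coeff_pCons_Suc)
      next
        case 2
        \<comment> \<open>Coefficient \<open>Suc l\<close> identifies \<beta> as a difference of
          consecutive subleading coefficients.\<close>
        have "B = (real l + 2) * (a + real l + 1) * (b + real l + 1) / ((e (Suc l) + real l + 1) * (e l + real l + 2))
             - (real l + 1) * (a + real l) * (b + real l) / ((e l + real l) * (e (Suc l) + real l))"
          unfolding B_def \<beta> c'_pred c'_e e_rec by (simp add: add_ac mult_ac)
        moreover have "coeff (p (Suc (Suc l))) (Suc l) =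
           - ((real l + 2) * (a + real l + 1) * (b + real l + 1) / ((e (Suc l) + real l + 1) * (e l + real l + 2)))"
          unfolding second e_rec by (simp add: add_ac)
        moreover have "coeff (p (Suc l)) (Suc l) = 1" "coeff (p l) (Suc l) = 0"
          using p[of "Suc l"] p[of l] by (simp_all add: coeff_eq_0)
        ultimately show ?thesis using g_coeff[OF i] second[of l] 2
          by (simp add: R)
      next
        case 3
        thus ?thesis using g_coeff[OF i] p[of l] p[of "Suc l"] p[of "Suc (Suc l)"]
          by (simp add: R coeff_eq_0)
      next
        case 4
        then obtain i' where "i = Suc i'" "i' > Suc l" by (cases i) auto
        thus ?thesis using g_coeff[OF i] p[of l] p[of "Suc l"] p[of "Suc (Suc l)"]
          by (simp add: R coeff_eq_0)
      qed
    next
      fix m assume m: "m < l"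
      then obtain q where l: "l = Suc q" by (cases l) auto
      \<comment> \<open>In \<open>?L m R\<close> only the x-multiple and \<open>g\<close> can
        contribute. Both vanish for \<open>m < q\<close>; at \<open>m = q\<close> both are diagonal
        values, and \<gamma> is their ratio.\<close>
      have "?L (m + 2) (p (Suc l)) = \<gamma> (int l) * ?L m (p q)"
      proof (cases "m = q")
        case False
        thus ?thesis using m l by (simp add: L_p)
      next
        case True
        show ?thesis
        proof (cases "q = 0")
          case True
          show ?thesis using functional_two_orthogonal_poly_step_0[OF pos] \<gamma>_one c'_pred[of 0] c'_e[of 0] \<open>m = q\<close> True l
            by (simp add: p_Q e_def shifted_param_def numeral_2_eq_2)
        next
          case False
          show ?thesis using functional_two_orthogonal_poly_step[OF pos, of q] \<gamma>[of q] False \<open>m = q\<close>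
            unfolding c'_pred c'_e p_Q l e_def by (simp add: add.commute)
        qed
      qed
      moreover have "g = smult (\<gamma> (int l)) (p q)" by (simp add: g_def p_def l)
      ultimately show "?L m R = 0" using m
        by (simp add: R moment_functional_add moment_functional_diff moment_functional_smult
          moment_functional_pCons_0 weight_moments_Suc L_p)
    qed
    hence "p (Suc (Suc l)) = [:- B, 1:] * p (Suc l) - smult A (p l) - g" by (simp add: R_def)
    moreover have "int (Suc l) + 1 = int (Suc (Suc l))" "int (Suc l) - 1 = int l" "int (Suc l) - 2 = int l - 1" by simp_all
    ultimately show ?thesis unfolding Suc p_def g_def A_def B_def by metis
  qed
  show ?thesis using P0 step by blast
qed

end
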